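(* Let $(a,b,c)\in\mathcal{C}$ and let $m,n\in\mathbb{N}\setminus\{0\}$ be such that $(a,b,c)=\mathfrak{P}(m,n)$. Then $(a,b,c)$ is primitive if and only if $n$ and $2m-1$ are relatively prime.
   Context: A Pythagorean triple is an ordered triple $(a,b,c)$ with $a,b,c\in\mathbb{N}\setminus\{0\}$ and $a^2+b^2=c^2$; it is primitive if $a$, $b$ and $c$ are relatively prime. The set $\mathcal{C}$ is the set of Pythagorean triples $$\mathcal{C}=\{(u^2-v^2,\,2uv,\,u^2+v^2)\;|\;u,v\in\mathbb{N}\setminus\{0\},\ u>v,\ u-v\text{ is odd}\}.$$ For $m,n\in\mathbb{N}\setminus\{0\}$, $\mathfrak{P}(m,n)$ denotes the triple $(a,b,c)\in\mathcal{C}$ given by $$a=-2n+4nm+4m^2-4m+1,\quad b=2n^2-2n+4nm,\quad c=2n^2-2n+4nm+4m^2-4m+1$$ (equivalently, the unique $(a,b,c)\in\mathcal{C}$ with $c-b=(2m-1)^2$ and $c-a=2n^2$). Every triple in $\mathcal{C}$ is of the form $\mathfrak{P}(m,n)$ for a unique pair $(m,n)$. *)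

theory Defs
  imports Complex_Main
begin

definition pythagorean_triple :: "nat \<times> nat \<times> nat \<Rightarrow> bool" where
  "pythagorean_triple = (\<lambda>(a, b, c). a > 0 \<and> b > 0 \<and> c > 0 \<and> a\<^sup>2 + b\<^sup>2 = c\<^sup>2)"

(* Relative primality of the three entries is read jointly: no common divisor of all
   three other than 1. For Pythagorean triples this agrees with pairwise coprimality. *)
definition primitive :: "nat \<times> nat \<times> nat \<Rightarrow> bool" where
  "primitive = (\<lambda>(a, b, c). pythagorean_triple (a, b, c) \<and> Gcd {a, b, c} = 1)"

(* The subtractions on nat do not truncate, because u > v. *)
definition \<C> :: "(nat \<times> nat \<times> nat) set" where
  "\<C> = {(u\<^sup>2 - v\<^sup>2, 2 * u * v, u\<^sup>2 + v\<^sup>2) | u v. u > 0 \<and> v > 0 \<and> u > v \<and> odd (u - v)}"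

(* The entries are computed in the integers. For m, n > 0 they are positive, so the
   conversion back to nat loses nothing (see \<PP>_int below). *)
definition \<PP> :: "nat \<Rightarrow> nat \<Rightarrow> nat \<times> nat \<times> nat" where
  "\<PP> m n =
     (nat (- 2 * int n + 4 * int n * int m + 4 * (int m)\<^sup>2 - 4 * int m + 1),
      nat (2 * (int n)\<^sup>2 - 2 * int n + 4 * int n * int m),
      nat (2 * (int n)\<^sup>2 - 2 * int n + 4 * int n * int m + 4 * (int m)\<^sup>2 - 4 * int m + 1))"

lemma \<PP>_int:
  assumes "m > 0" "n > 0" "\<PP> m n = (a, b, c)"
  shows "int a = - 2 * int n + 4 * int n * int m + 4 * (int m)\<^sup>2 - 4 * int m + 1"
    and "int b = 2 * (int n)\<^sup>2 - 2 * int n + 4 * int n * int m"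
    and "int c = 2 * (int n)\<^sup>2 - 2 * int n + 4 * int n * int m + 4 * (int m)\<^sup>2 - 4 * int m + 1"
proof -
  have nm: "int n \<le> int n * int m"
    using assms(1) mult_left_mono[of 1 "int m" "int n"] by simp
  have sq: "0 \<le> 4 * (int m)\<^sup>2 - 4 * int m + 1"
    using zero_le_power2[of "2 * int m - 1"] by (simp add: power2_eq_square algebra_simps)
  have n2: "0 \<le> (int n)\<^sup>2"
    by simp
  have nn: "0 \<le> int n"
    by simp
  have A: "0 \<le> - 2 * int n + 4 * int n * int m + 4 * (int m)\<^sup>2 - 4 * int m + 1"
    and B: "0 \<le> 2 * (int n)\<^sup>2 - 2 * int n + 4 * int n * int m"
    using nm sq n2 nn by linarith+
  then have C: "0 \<le> 2 * (int n)\<^sup>2 - 2 * int n + 4 * int n * int m + 4 * (int m)\<^sup>2 - 4 * int m + 1"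
    using n2 by linarith
  show "int a = - 2 * int n + 4 * int n * int m + 4 * (int m)\<^sup>2 - 4 * int m + 1"
    and "int b = 2 * (int n)\<^sup>2 - 2 * int n + 4 * int n * int m"
    and "int c = 2 * (int n)\<^sup>2 - 2 * int n + 4 * int n * int m + 4 * (int m)\<^sup>2 - 4 * int m + 1"
    using assms(3) A B C unfolding \<PP>_def by auto
qed

lemma \<PP>_in_\<C>:
  assumes "m > 0" "n > 0"
  shows "\<PP> m n \<in> \<C>"
proof -
  obtain k where m: "m = Suc k"
    using assms(1) gr0_implies_Suc by blast
  define u where "u = n + 2 * k + 1"
  obtain a b c where P: "\<PP> m n = (a, b, c)"
    by (cases "\<PP> m n")
  have vu: "n\<^sup>2 \<le> u\<^sup>2"
    unfolding u_def by (intro power_mono) auto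
  have "int a = int (u\<^sup>2 - n\<^sup>2)" "int b = int (2 * u * n)" "int c = int (u\<^sup>2 + n\<^sup>2)"
    using \<PP>_int[OF assms P] vu
    by (simp_all add: of_nat_diff m u_def power2_eq_square algebra_simps)
  then have "a = u\<^sup>2 - n\<^sup>2" "b = 2 * u * n" "c = u\<^sup>2 + n\<^sup>2"
    by (simp_all only: of_nat_eq_iff)
  moreover have "u > 0" "u > n" "odd (u - n)"
    by (auto simp: u_def)
  ultimately show ?thesis
    using assms(2) P unfolding \<C>_def by blast
qed

end

(* With w = 2m - 1, the triple is (w (w + 2n), 2n (n + w), w^2 + 2nw + 2n^2). A common divisor
   of n and w divides all three entries; conversely, a common divisor of the entries divides
   c - b = w^2 and c - a = 2n^2, which are coprime if n and w are, since w is odd. *)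
theory Submission
  imports Defs
begin

theorem theorem2:
  fixes a b c m n :: nat
  assumes "(a, b, c) \<in> \<C>"
    and "m > 0" and "n > 0"
    and "(a, b, c) = \<PP> m n"
  shows "primitive (a, b, c) \<longleftrightarrow> coprime n (2 * m - 1)"
proof -
  define w where "w = 2 * m - 1"
  \<comment> \<open>Since \<open>m > 0\<close>, the subtraction in \<open>w\<close> does not
    truncate on nat.\<close>
  have w: "int w = 2 * int m - 1" "odd w"
    using assms(2) by (auto simp: w_def of_nat_diff)
  \<comment> \<open>In \<open>w\<close> and \<open>n\<close> the entries have no negative terms, so
    these identities carry over from int to nat.\<close>
  have "int a = int (w * (w + 2 * n))" "int b = int (2 * n * (n + w))"
    "int c = int (w\<^sup>2 + 2 * n * w + 2 * n\<^sup>2)"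
    unfolding \<PP>_int[OF assms(2,3) assms(4)[symmetric]] of_nat_add of_nat_mult of_nat_power w(1)
    by (simp_all add: power2_eq_square algebra_simps)
  then have a: "a = w * (w + 2 * n)" and b: "b = 2 * n * (n + w)"
    and c: "c = w\<^sup>2 + 2 * n * w + 2 * n\<^sup>2"
    by (simp_all only: of_nat_eq_iff)
  have "a > 0" "b > 0" "c > 0"
    using odd_pos[OF w(2)] assms(3) by (simp_all add: a b c)
  moreover have "a\<^sup>2 + b\<^sup>2 = c\<^sup>2"
    unfolding a b c by algebra
  ultimately have prim: "primitive (a, b, c) \<longleftrightarrow> Gcd {a, b, c} = 1"
    by (simp add: primitive_def pythagorean_triple_def)
  have "Gcd {a, b, c} = 1 \<longleftrightarrow> coprime n w"
  proof
    assume gcd1: "Gcd {a, b, c} = 1"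
    show "coprime n w"
    proof (rule coprimeI)
      fix d assume "d dvd n" "d dvd w"
      then have "d dvd a" "d dvd b" "d dvd c"
        by (simp_all add: a b c power2_eq_square)
      then have "d dvd Gcd {a, b, c}"
        by (auto intro: Gcd_greatest)
      then show "is_unit d"
        by (simp only: gcd1)
    qed
  next
    assume nw: "coprime n w"
    let ?g = "Gcd {a, b, c}"
    have g: "?g dvd a" "?g dvd b" "?g dvd c"
      by (rule Gcd_dvd, simp)+
    \<comment> \<open>Stated as sums, the differences \<open>c - b\<close> and \<open>c - a\<close>
      avoid truncated subtraction: a divisor of the sum and of one summand divides the
      other.\<close>
    have "c = b + w\<^sup>2" "c = a + 2 * n\<^sup>2"
      by (simp_all add: a b c power2_eq_square algebra_simps)
    then have "?g dvd w\<^sup>2" "?g dvd 2 * n\<^sup>2"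
      using g dvd_add_right_iff by metis+
    \<comment> \<open>Oddness of \<open>w\<close> handles the factor 2; \<open>nw\<close> handles
      the square of \<open>n\<close>.\<close>
    moreover have "coprime (w\<^sup>2) (2 * n\<^sup>2)"
      using nw w(2) by (simp add: coprime_commute)
    ultimately show "?g = 1"
      by (meson coprime_common_divisor_nat nat_dvd_1_iff_1)
  qed
  then show ?thesis
    using prim by (simp add: w_def)
qed

end
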